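(* Let $n\ge m\ge 0$ be integers of the same parity. The coefficient function for the mapping from $\{x^m,x^{m+2},\ldots,x^n\}$ to $\{R_n^n(x),R_n^{n-2}(x),\ldots,R_n^{m+2}(x),R_n^m(x)\}$ is $$\beta(n,m,k)=(-1)^k\,\frac{(m+1)_{v-k-1}\,(n-2k)}{(v-k)!\,\binom{v+m}{v}},\qquad v=\frac{n-m}{2},\quad 0\le k\le v.$$ That is, for every integer $p$ with $m\le p\le n$ and $p\equiv n \pmod 2$, $$x^p=\sum_{k=0}^{(n-p)/2}\beta(n,p,k)\,R_n^{n-2k}(x).$$
   Context: For integers $0\le m\le n$ with $n-m$ even, the Zernike Radial polynomial is $$R_n^m(x)=\sum_{k=0}^{(n-m)/2}\binom{n-k}{k}\binom{n-2k}{\frac{n-m}{2}-k}(-1)^k x^{n-2k}.$$ $(a)_r=\Gamma(a+r)/\Gamma(a)$ is the Pochhammer symbol, so $(m+1)_{-1}=1/m$ for $m\geq 1$. When $k=v$ one has $n-2k=m$ and the product $(m+1)_{-1}\,(n-2k)$ is understood to equal $1$, also when $m=0$; hence $\beta(n,m,v)=(-1)^v/\binom{v+m}{v}$. *)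

theory Defs
  imports "HOL-Analysis.Gamma_Function"
begin

text \<open>Only meaningful for \<open>m \<le> n\<close> with \<open>n - m\<close> even; then no natural-number subtraction or
  division below truncates.\<close>

definition zernike_R :: "nat \<Rightarrow> nat \<Rightarrow> real \<Rightarrow> real" where
  "zernike_R n m x =
     (\<Sum>k=0..(n - m) div 2.
        real ((n - k) choose k) * real ((n - 2 * k) choose ((n - m) div 2 - k)) * (-1) ^ k
          * x ^ (n - 2 * k))"

text \<open>The library's \<^const>\<open>pochhammer\<close> takes a natural-number index, but the index \<open>-1\<close> is needed.\<close>

definition poch :: "real \<Rightarrow> int \<Rightarrow> real" where
  "poch a r = Gamma (a + of_int r) / Gamma a"

lemma poch_of_nat: "a > 0 \<Longrightarrow> poch a (int j) = pochhammer a j"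
  by (simp add: poch_def pochhammer_Gamma nonpos_Ints_def)

lemma poch_minus_one:
  assumes "m \<ge> 1"
  shows "poch (real m + 1) (-1) = 1 / real m"
proof -
  have "Gamma (real m + 1) = real m * Gamma (real m)"
    using assms by (intro Gamma_plus1) (auto simp: nonpos_Ints_def)
  moreover have "Gamma (real m) > 0"
    using assms by (intro Gamma_real_pos) auto
  ultimately show ?thesis by (simp add: poch_def)
qed

text \<open>At \<open>k = v\<close> the index is \<open>-1\<close> and \<open>n - 2 * k = m\<close>. For \<open>m \<ge> 1\<close> the product
  \<open>poch (m + 1) (-1) * m\<close> is \<open>1\<close> by \<open>poch_minus_one\<close>; for \<open>m = 0\<close> it is \<open>1\<close> by convention
  (the Gamma quotient has a pole there, and would give \<open>0\<close>).\<close>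

definition zernike_beta :: "nat \<Rightarrow> nat \<Rightarrow> nat \<Rightarrow> real" where
  "zernike_beta n m k =
     (let v = (n - m) div 2 in
        (-1) ^ k
          * (if k = v then 1
             else poch (real m + 1) (int v - int k - 1) * real (n - 2 * k))
          / (fact (v - k) * real ((v + m) choose v)))"

end

theory Submission imports Defs
begin

text \<open>
  Write \<open>n = p + 2 * v\<close>. Every index occurring in the statement becomes subtraction-free when it is
  counted from the lowest power \<open>x ^ p\<close> upwards: the summand \<open>k = v - d\<close> carries the polynomial
  \<open>R_n^(p + 2 * d)\<close>, whose monomials are \<open>x ^ (p + 2 * N)\<close> with \<open>d \<le> N \<le> v\<close>. In these
  coordinates the coefficient of \<open>x ^ (p + 2 * N)\<close> in \<open>R_n^(p + 2 * d)\<close> is, up to a factor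
  independent of \<open>d\<close>, \<open>1 / ((N - d)! * (p + N + d)!)\<close>
  (\<open>zernike_R_from_lowest_power\<close>), and \<open>\<beta>\<close> is, up to a factor \<open>(-1) ^ d\<close> and one
  independent of \<open>d\<close>, \<open>(p + 2 * d) * (p + d - 1)! / d!\<close> (\<open>zernike_beta_from_lowest_power\<close>).

  Collecting powers of \<open>x\<close> after exchanging the two sums, the theorem says that summing the product
  of these two expressions over \<open>d\<close> annihilates every power except \<open>x ^ p\<close> itself. This is the
  alternating sum \<open>alternating_weight_sum\<close>, which does not involve \<open>v\<close>. It holds because the sum telescopes: its
  partial sums are hypergeometric terms containing the factor \<open>N - D\<close>, which vanishes when the
  summation is complete (\<open>alternating_weight_partial_sum\<close>).
\<close>

text \<open>The product \<open>(p + 2 * d) * (p + d - 1)!\<close>. Separating the case \<open>d = 0\<close> gives it the value \<open>p!\<close>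
  there even for \<open>p = 0\<close>, in agreement with the convention for the index \<open>-1\<close> of the Pochhammer
  symbol.\<close>

fun weight :: "nat \<Rightarrow> nat \<Rightarrow> real" where
  "weight p 0 = fact p"
| "weight p (Suc d) = real (p + 2 * Suc d) * fact (p + d)"

text \<open>The closed form is the one found by Gosper's summation algorithm. Once the
  common factors are cancelled, the induction step is the identity
  \<open>(D + 1) * (p + N + D + 1) - N * (p + 2 * D + 2) = -(N - D - 1) * (p + D + 1)\<close>.\<close>

lemma alternating_weight_partial_sum:
  assumes "D \<le> N" and "N > 0"
  shows "(\<Sum>d\<le>D. (-1) ^ d * weight p d / (fact d * fact (N - d) * fact (p + N + d)))
         = (-1) ^ D * fact (p + D) * real (N - D) / (real N * fact D * fact (N - D) * fact (p + N + D))"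
  using assms(1)
proof (induction D)
  case 0
  then show ?case using assms(2) by simp
next
  case (Suc D)
  then obtain e where N: "N = Suc (D + e)"
    by (metis Suc_le_D add_Suc le_add_diff_inverse)
  have diffs: "N - D = Suc e" "N - Suc D = e"
    using N by auto
  define A F G H B :: real where
    "A = fact (p + D)" and "F = fact D" and "G = fact e" and "H = fact (p + N + D)" and "B = (-1) ^ D"
  have nz: "A > 0" "F > 0" "G > 0" "H > 0" by (simp_all add: A_def F_def G_def H_def)
  have facts:
    "fact (p + Suc D) = (real (p + D) + 1) * A" "fact (Suc D) = (real D + 1) * F"
    "fact (N - D) = (real e + 1) * G" "fact (N - Suc D) = G"
    "fact (p + N + Suc D) = (real (p + N + D) + 1) * H" "(-1) ^ Suc D = - B"
    "weight p (Suc D) = real (p + 2 * Suc D) * A" "real (N - D) = real e + 1"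
    "real (N - Suc D) = real e"
    by (simp_all add: diffs A_def B_def F_def G_def H_def add_ac)
  have "(\<Sum>d\<le>Suc D. (-1) ^ d * weight p d / (fact d * fact (N - d) * fact (p + N + d)))
      = B * A * (real e + 1) / (real N * F * ((real e + 1) * G) * H)
        + - B * (real (p + 2 * Suc D) * A)
          / ((real D + 1) * F * G * ((real (p + N + D) + 1) * H))"
    using Suc by (simp only: sum.atMost_Suc facts Suc_leD A_def[symmetric] F_def[symmetric]
        H_def[symmetric] B_def[symmetric])
  also have "\<dots> = - B * ((real (p + D) + 1) * A) * real e
          / (real N * ((real D + 1) * F) * G * ((real (p + N + D) + 1) * H))"
    using nz by (simp add: N divide_simps add_nonneg_eq_0_iff) (simp add: algebra_simps)
  finally show ?case
    by (simp only: facts)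
qed

lemma alternating_weight_sum:
  "(\<Sum>d\<le>N. (-1) ^ d * weight p d / (fact d * fact (N - d) * fact (p + N + d)))
   = (if N = 0 then 1 else 0)"
  using alternating_weight_partial_sum[of N N p] by (cases "N = 0") auto

text \<open>The substitution \<open>N = v - j\<close> in the defining sum. The two binomial coefficients share the
  factorial \<open>(n - 2 * j)! = (p + 2 * N)!\<close>, whose cancellation leaves \<open>d\<close> in two factorials of the
  denominator only.\<close>

lemma zernike_R_from_lowest_power:
  assumes "d \<le> v"
  shows "zernike_R (p + 2 * v) (p + 2 * d) x
         = (\<Sum>N=d..v. (-1) ^ (v - N) * fact (p + v + N)
                     / (fact (v - N) * fact (N - d) * fact (p + N + d)) * x ^ (p + 2 * N))"
proof -
  have coeff: "real ((p + 2 * v - j) choose j) * real ((p + 2 * v - 2 * j) choose (v - d - j))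
      = fact (p + v + N) / (fact j * fact (N - d) * fact (p + N + d))"
    if "d \<le> N" "N \<le> v" and j: "j = v - N" for N j
  proof -
    have *: "p + 2 * v - j = p + v + N" "p + 2 * v - 2 * j = p + 2 * N" "v - d - j = N - d"
      using that by auto
    have "real ((p + v + N) choose j) = fact (p + v + N) / (fact j * fact (p + 2 * N))"
      using that by (subst binomial_fact) (auto intro!: arg_cong[where f = fact] simp: algebra_simps)
    moreover have "real ((p + 2 * N) choose (N - d)) = fact (p + 2 * N) / (fact (N - d) * fact (p + N + d))"
      using that by (subst binomial_fact) (auto intro!: arg_cong[where f = fact] simp: algebra_simps)
    ultimately show ?thesis
      unfolding * by simp
  qed
  have half: "(p + 2 * v - (p + 2 * d)) div 2 = v - d"
    using assms by auto
  show ?thesis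
    unfolding zernike_R_def half
  proof (rule sum.reindex_bij_witness[of _ "\<lambda>N. v - N" "\<lambda>j. v - j"])
    fix j assume j: "j \<in> {0..v - d}"
    have "p + 2 * v - 2 * j = p + 2 * (v - j)" using j assms by auto
    then show "(-1) ^ (v - (v - j)) * fact (p + v + (v - j))
              / (fact (v - (v - j)) * fact (v - j - d) * fact (p + (v - j) + d)) * x ^ (p + 2 * (v - j))
          = real ((p + 2 * v - j) choose j)
              * real ((p + 2 * v - 2 * j) choose ((v - d) - j)) * (-1) ^ j * x ^ (p + 2 * v - 2 * j)"
      using j assms coeff[of "v - j" j] by simp
  qed (use assms in auto)
qed

text \<open>The factor \<open>p!\<close> in the denominator of the Pochhammer symbol cancels against the one in the
  reciprocal binomial coefficient; this is why \<open>p\<close> and \<open>d\<close> are coupled only through \<^const>\<open>weight\<close>.\<close>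

lemma zernike_beta_from_lowest_power:
  assumes "d \<le> v"
  shows "zernike_beta (p + 2 * v) p (v - d)
         = (-1) ^ (v - d) * fact v / fact (p + v) * (weight p d / fact d)"
proof -
  have binom: "real ((v + p) choose v) = fact (p + v) / (fact v * fact p)"
    by (subst binomial_fact) (auto simp: add.commute)
  show ?thesis
  proof (cases d)
    case 0
    then show ?thesis
      using binom by (simp add: zernike_beta_def)
  next
    case (Suc e)
    have index: "int d - 1 = int e" and degree: "p + 2 * v - 2 * (v - d) = p + 2 * d"
      using Suc assms by auto
    have "poch (real p + 1) (int e) = pochhammer (real p + 1) e"
      by (intro poch_of_nat) auto
    also have "\<dots> = fact (p + e) / fact p"
      using pochhammer_product'[of "1 :: real" p e]
      by (simp add: pochhammer_fact[symmetric] add.commute)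
    finally have gamma: "poch (real p + 1) (int e) = fact (p + e) / fact p" .
    have "v - d \<noteq> v" using Suc assms by auto
    then have "zernike_beta (p + 2 * v) p (v - d)
        = (-1) ^ (v - d) * (fact (p + e) / fact p * real (p + 2 * d))
          / (fact d * (fact (p + v) / (fact v * fact p)))"
      using assms binom by (simp add: zernike_beta_def Let_def index degree gamma)
    also have "\<dots> = (-1) ^ (v - d) * fact v / fact (p + v) * (weight p d / fact d)"
      using Suc by (simp add: mult_ac)
    finally show ?thesis .
  qed
qed

text \<open>After exchanging the two sums, the coefficient of \<open>x ^ (p + 2 * N)\<close> is a
  multiple of the alternating sum, and only \<open>N = 0\<close> survives.\<close>

lemma monomial_expansion:
  "x ^ p = (\<Sum>k=0..v. zernike_beta (p + 2 * v) p k * zernike_R (p + 2 * v) (p + 2 * v - 2 * k) x)"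
proof -
  let ?s = "\<lambda>N d. (-1) ^ d * weight p d / (fact d * fact (N - d) * fact (p + N + d))"
  let ?C = "\<lambda>N. (-1) ^ N * fact v * fact (p + v + N) / (fact (p + v) * fact (v - N)) * x ^ (p + 2 * N)"
  have "(\<Sum>k=0..v. zernike_beta (p + 2 * v) p k * zernike_R (p + 2 * v) (p + 2 * v - 2 * k) x)
      = (\<Sum>d=0..v. zernike_beta (p + 2 * v) p (v - d) * zernike_R (p + 2 * v) (p + 2 * d) x)"
    by (rule sum.reindex_bij_witness[of _ "\<lambda>d. v - d" "\<lambda>k. v - k"])
       (auto intro!: arg_cong2[where f = "zernike_R (p + 2 * v)"])
  also have "\<dots> = (\<Sum>d=0..v. \<Sum>N=d..v. ?C N * ?s N d)"
  proof (intro sum.cong refl)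
    fix d assume "d \<in> {0..v}"
    then have "d \<le> v" by simp
    show "zernike_beta (p + 2 * v) p (v - d) * zernike_R (p + 2 * v) (p + 2 * d) x
        = (\<Sum>N=d..v. ?C N * ?s N d)"
      unfolding zernike_beta_from_lowest_power[OF \<open>d \<le> v\<close>]
        zernike_R_from_lowest_power[OF \<open>d \<le> v\<close>] sum_distrib_left
    proof (intro sum.cong refl)
      fix N assume "N \<in> {d..v}"
      then have "(-1) ^ (v - d) * (-1) ^ (v - N) = (-1) ^ N * (-1 :: real) ^ d"
        using \<open>d \<le> v\<close> by (auto simp: minus_one_power_iff)
      from arg_cong[OF this, of "\<lambda>t. t * (fact v / fact (p + v) * (weight p d / fact d)
            * (fact (p + v + N) / (fact (v - N) * fact (N - d) * fact (p + N + d)) * x ^ (p + 2 * N)))"]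
      show "(-1) ^ (v - d) * fact v / fact (p + v) * (weight p d / fact d)
          * ((-1) ^ (v - N) * fact (p + v + N) / (fact (v - N) * fact (N - d) * fact (p + N + d))
              * x ^ (p + 2 * N))
        = ?C N * ?s N d"
        by (simp add: mult_ac)
    qed
  qed
  also have "\<dots> = (\<Sum>N=0..v. \<Sum>d\<le>N. ?C N * ?s N d)"
    by (simp add: sum.Sigma) (rule sum.reindex_bij_witness[of _ prod.swap prod.swap], auto)
  also have "\<dots> = (\<Sum>N=0..v. ?C N * (if N = 0 then 1 else 0))"
    by (simp only: sum_distrib_left[symmetric] alternating_weight_sum)
  also have "\<dots> = x ^ p"
    by (subst sum.atLeast_Suc_atMost) auto
  finally show ?thesis by simp
qed

theorem theorem6:
  fixes n m :: nat
  assumes "m \<le> n" and "m mod 2 = n mod 2"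
  shows "\<forall>p::nat. m \<le> p \<and> p \<le> n \<and> p mod 2 = n mod 2 \<longrightarrow>
    (\<forall>x::real. x ^ p = (\<Sum>k=0..(n - p) div 2. zernike_beta n p k * zernike_R n (n - 2 * k) x))"
proof (intro allI impI)
  fix p :: nat and x :: real
  assume "m \<le> p \<and> p \<le> n \<and> p mod 2 = n mod 2"
  then have "n = p + 2 * ((n - p) div 2)"
    by presburger
  then show "x ^ p = (\<Sum>k=0..(n - p) div 2. zernike_beta n p k * zernike_R n (n - 2 * k) x)"
    using monomial_expansion[of x p "(n - p) div 2"] by simp
qed

end
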